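(* If the incentive graph is a spanning supergraph of the synergy graph, i.e. $g_{ij}\ge\tilde g_{ij}$ for all $i$ and $j$, then full revelation is optimal.
   Context: Model. There are one principal and $n$ agents. Agent $i$ chooses $a_i\in\mathbb R$; $\mathbf a=(a_1,\dots,a_n)'$. The state $\mathbf x=(x_1,\dots,x_n)'$ is distributed as $N(\mu\mathbf 1_n,\sigma^2 I_n)$, with $\mu\in\mathbb R$, $\sigma^2>0$, $\mathbf 1_n$ the vector of ones. The incentive graph $G=[g_{ij}]$ and the synergy graph $\widetilde G=[\tilde g_{ij}]$ are symmetric $n\times n$ matrices with entries in $\{0,1\}$ and zero diagonal; $\beta\ge0$ is a parameter. Agent $i$'s payoff is $u_i(\mathbf a,\mathbf x)=-(a_i-x_i)^2-\beta\sum_{j} g_{ij}(a_i-a_j)^2$; the principal's payoff is $v(\mathbf a,\mathbf x)=-\sum_i (a_i-x_i)^2-\beta\sum_i\sum_j\tilde g_{ij}(a_i-a_j)^2$. A public signal is a map (Markov kernel) $\varphi:\mathbb R^n\to\Delta(M)$, $M$ a measurable space. All agents observe the realization $m$ and nothing else, form $\hat{\mathbf x}=\mathbb E[\mathbf x\mid m]$, and play the unique Nash equilibrium $\mathbf a^*=B\hat{\mathbf x}$, $B=(I_n+\beta L)^{-1}$, where $L=D_G-G$ and $\widetilde L=D_{\widetilde G}-\widetilde G$ are the graph Laplacians ($D$ the diagonal degree matrix). Then $\mathbb E[v(\mathbf a^*,\mathbf x)]=-\mathbb E[\mathbf x'\mathbf x]+\mathbb E[\hat{\mathbf x}'V\hat{\mathbf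 x}]$ with $V=B'(I_n-2\beta(\widetilde L-L))B$. A signal is optimal if it maximizes $\mathbb E[v(\mathbf a^*,\mathbf x)]$ (equivalently $\mathbb E[\hat{\mathbf x}'V\hat{\mathbf x}]$) over all public signals. Full revelation is the signal $m=\mathbf x$. *)

theory Defs
  imports "HOL-Probability.Probability"
begin

definition graph_matrix :: "real^'n^'n \<Rightarrow> bool" where
  "graph_matrix G \<longleftrightarrow>
     (\<forall>i j. G $ i $ j \<in> {0, 1}) \<and> transpose G = G \<and> (\<forall>i. G $ i $ i = 0)"

definition agent_payoff :: "real \<Rightarrow> real^'n^'n \<Rightarrow> 'n \<Rightarrow> real^'n \<Rightarrow> real^'n \<Rightarrow> real" where
  "agent_payoff \<beta> G i a x =
     - (a $ i - x $ i)\<^sup>2 - \<beta> * (\<Sum>j\<in>UNIV. G $ i $ j * (a $ i - a $ j)\<^sup>2)"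

definition principal_payoff :: "real \<Rightarrow> real^'n^'n \<Rightarrow> real^'n \<Rightarrow> real^'n \<Rightarrow> real" where
  "principal_payoff \<beta> Gt a x =
     - (\<Sum>i\<in>UNIV. (a $ i - x $ i)\<^sup>2)
     - \<beta> * (\<Sum>i\<in>UNIV. \<Sum>j\<in>UNIV. Gt $ i $ j * (a $ i - a $ j)\<^sup>2)"

definition laplacian :: "real^'n^'n \<Rightarrow> real^'n^'n" where
  "laplacian G = (\<chi> i j. (if i = j then (\<Sum>k\<in>UNIV. G $ i $ k) else 0) - G $ i $ j)"

text \<open>
  A normal vector with mean \<open>\<mu> \<cdot> \<one>\<close> and covariance \<open>\<sigma>\<^sup>2 \<cdot> I\<close>
  has independent coordinates, each with law \<open>N(\<mu>, \<sigma>\<^sup>2)\<close>; the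
  parameter \<open>\<sigma>\<close> is the standard deviation.
\<close>

definition state_law :: "real \<Rightarrow> real \<Rightarrow> (real^'n) measure" where
  "state_law \<mu> \<sigma> =
     distr (\<Pi>\<^sub>M i\<in>UNIV. density lborel (\<lambda>t. ennreal (normal_density \<mu> \<sigma> t))) borel vec_lambda"

definition public_signal :: "'m measure \<Rightarrow> (real^'n \<Rightarrow> 'm measure) \<Rightarrow> bool" where
  "public_signal M \<phi> \<longleftrightarrow> \<phi> \<in> borel \<rightarrow>\<^sub>M prob_algebra M"

definition full_revelation :: "real^'n \<Rightarrow> (real^'n) measure" where
  "full_revelation = return borel"

definition joint_law ::
  "real \<Rightarrow> real \<Rightarrow> 'm measure \<Rightarrow> (real^'n \<Rightarrow> 'm measure) \<Rightarrow> ((real^'n) \<times> 'm) measure" where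
  "joint_law \<mu> \<sigma> M \<phi> =
     state_law \<mu> \<sigma> \<bind> (\<lambda>x. distr (\<phi> x) (borel \<Otimes>\<^sub>M M) (\<lambda>m. (x, m)))"

text \<open>Conditioning on this \<open>\<sigma>\<close>-algebra is conditioning on the message.\<close>

definition message_algebra :: "'m measure \<Rightarrow> ('x \<times> 'm) measure" where
  "message_algebra M = vimage_algebra (UNIV \<times> space M) snd M"

definition cond_exp_message ::
  "real \<Rightarrow> real \<Rightarrow> 'm measure \<Rightarrow> (real^'n \<Rightarrow> 'm measure) \<Rightarrow>
   ((real^'n) \<times> 'm \<Rightarrow> real) \<Rightarrow> (real^'n) \<times> 'm \<Rightarrow> real" where
  "cond_exp_message \<mu> \<sigma> M \<phi> = real_cond_exp (joint_law \<mu> \<sigma> M \<phi>) (message_algebra M)"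

definition posterior_mean ::
  "real \<Rightarrow> real \<Rightarrow> 'm measure \<Rightarrow> (real^'n \<Rightarrow> 'm measure) \<Rightarrow> (real^'n) \<times> 'm \<Rightarrow> real^'n" where
  "posterior_mean \<mu> \<sigma> M \<phi> \<omega> = (\<chi> i. cond_exp_message \<mu> \<sigma> M \<phi> (\<lambda>(x, m). x $ i) \<omega>)"

text \<open>
  Letting the deviation \<open>d\<close> depend on the message is the same as asking, for almost every
  message \<open>m\<close>, that \<open>a m\<close> be a Nash equilibrium of the game played after \<open>m\<close>.
  Payoffs are nonpositive and strategies are functions of the message, so these conditional
  expectations are almost surely finite although the payoff of an arbitrary strategy profile
  need not be integrable.
\<close>

definition nash_equilibrium ::
  "real \<Rightarrow> real \<Rightarrow> real \<Rightarrow> real^'n^'n \<Rightarrow> 'm measure \<Rightarrow> (real^'n \<Rightarrow> 'm measure) \<Rightarrow>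
   ('m \<Rightarrow> real^'n) \<Rightarrow> bool" where
  "nash_equilibrium \<mu> \<sigma> \<beta> G M \<phi> a \<longleftrightarrow>
     a \<in> borel_measurable M \<and>
     (\<forall>i. \<forall>d \<in> borel_measurable M. AE \<omega> in joint_law \<mu> \<sigma> M \<phi>.
        cond_exp_message \<mu> \<sigma> M \<phi>
          (\<lambda>(x, m). agent_payoff \<beta> G i (\<chi> j. if j = i then d m else a m $ j) x) \<omega>
        \<le> cond_exp_message \<mu> \<sigma> M \<phi> (\<lambda>(x, m). agent_payoff \<beta> G i (a m) x) \<omega>)"

text \<open>
  The equilibrium is unique only up to null sets of messages, so what is selected is the
  principal's expected payoff, which all equilibria share. Existence, uniqueness and the
  closed form \<open>(I + \<beta>L)\<^sup>-\<^sup>1 *v E[x | m]\<close> of the equilibrium are proved below.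
\<close>

definition principal_value ::
  "real \<Rightarrow> real \<Rightarrow> real \<Rightarrow> real^'n^'n \<Rightarrow> real^'n^'n \<Rightarrow> 'm measure \<Rightarrow> (real^'n \<Rightarrow> 'm measure) \<Rightarrow> real" where
  "principal_value \<mu> \<sigma> \<beta> G Gt M \<phi> =
     (THE v. \<exists>a. nash_equilibrium \<mu> \<sigma> \<beta> G M \<phi> a \<and>
        v = (\<integral>(x, m). principal_payoff \<beta> Gt (a m) x \<partial>joint_law \<mu> \<sigma> M \<phi>))"

text \<open>
  HOL cannot quantify over types inside a formula, so the type of the competing signals' messages
  is a parameter; a theorem that leaves \<open>'m\<close> free covers all public signals.
\<close>

definition optimal_signal ::
  "'m itself \<Rightarrow> real \<Rightarrow> real \<Rightarrow> real \<Rightarrow> real^'n^'n \<Rightarrow> real^'n^'n \<Rightarrow>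
   'k measure \<Rightarrow> (real^'n \<Rightarrow> 'k measure) \<Rightarrow> bool" where
  "optimal_signal T \<mu> \<sigma> \<beta> G Gt N \<psi> \<longleftrightarrow>
     public_signal N \<psi> \<and>
     (\<forall>(M :: 'm measure) \<phi>. public_signal M \<phi> \<longrightarrow>
        principal_value \<mu> \<sigma> \<beta> G Gt M \<phi> \<le> principal_value \<mu> \<sigma> \<beta> G Gt N \<psi>)"

lemma vec_nth_borel [measurable]: "(\<lambda>x :: real^'n. x $ i) \<in> borel_measurable borel"
  by (intro borel_measurable_continuous_onI continuous_on_component continuous_on_id)

lemma vec_borel_iff:
  fixes f :: "'a \<Rightarrow> real^'n"
  shows "f \<in> borel_measurable M \<longleftrightarrow> (\<forall>i. (\<lambda>x. f x $ i) \<in> borel_measurable M)"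
proof
  assume "f \<in> borel_measurable M"
  then show "\<forall>i. (\<lambda>x. f x $ i) \<in> borel_measurable M" by simp
next
  assume *: "\<forall>i. (\<lambda>x. f x $ i) \<in> borel_measurable M"
  show "f \<in> borel_measurable M"
    by (rule borel_measurable_euclidean_space[THEN iffD2])
       (use * in \<open>auto simp: Basis_vec_def inner_axis\<close>)
qed

lemma mult_vec_borel [measurable]:
  fixes A :: "real^'n^'n"
  assumes [measurable]: "f \<in> borel_measurable M"
  shows "(\<lambda>x. A *v f x) \<in> borel_measurable M"
  unfolding vec_borel_iff by (simp add: matrix_vector_mult_def)

lemma vec_lambda_borel:
  fixes N :: "real measure"
  assumes "sets N = sets borel"
  shows "vec_lambda \<in> (\<Pi>\<^sub>M i\<in>(UNIV::'n::finite set). N) \<rightarrow>\<^sub>M (borel :: (real^'n) measure)"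
proof -
  have "(\<lambda>f. f i) \<in> borel_measurable (\<Pi>\<^sub>M i\<in>(UNIV::'n::finite set). N)" for i
    using measurable_component_singleton[of i UNIV "\<lambda>_. N"] assms
    by (simp cong: measurable_cong_sets)
  then show ?thesis unfolding vec_borel_iff by simp
qed

lemma sets_state_law [simp, measurable_cong]: "sets (state_law \<mu> \<sigma>) = sets borel"
  and space_state_law [simp]: "space (state_law \<mu> \<sigma>) = UNIV"
  by (simp_all add: state_law_def)

lemma state_law_component:
  assumes "\<sigma> > 0"
  shows "distr (state_law \<mu> \<sigma> :: (real^'n) measure) borel (\<lambda>x. x $ i) = 
    density lborel (\<lambda>t. ennreal (normal_density \<mu> \<sigma> t))"
proof -
  let ?N = "density lborel (\<lambda>t. ennreal (normal_density \<mu> \<sigma> t))"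
  interpret N: prob_space ?N by (rule prob_space_normal_density[OF assms])
  have "distr (state_law \<mu> \<sigma> :: (real^'n) measure) borel (\<lambda>x. x $ i) 
     = distr (\<Pi>\<^sub>M i\<in>(UNIV::'n set). ?N) borel (\<lambda>f. f i)"
    unfolding state_law_def 
    by (subst distr_distr) (auto simp: comp_def intro!: vec_lambda_borel)
  also have "\<dots> = distr (\<Pi>\<^sub>M i\<in>(UNIV::'n set). ?N) ?N (\<lambda>f. f i)"
    by (rule distr_cong) auto
  also have "\<dots> = ?N" by (rule distr_PiM_component) (auto intro: N.prob_space_axioms)
  finally show ?thesis .
qed

lemma prob_space_state_law:
  assumes "\<sigma> > 0" shows "prob_space (state_law \<mu> \<sigma>)"
  unfolding state_law_def
  by (intro prob_space.prob_space_distr prob_space_PiM prob_space_normal_density assms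
      vec_lambda_borel) auto

lemma state_law_square_integrable:
  assumes "\<sigma> > 0"
  shows "integrable (state_law \<mu> \<sigma> :: (real^'n) measure) (\<lambda>x. (x $ i)\<^sup>2)"
proof -
  have 1: "integrable lborel (\<lambda>t. normal_density \<mu> \<sigma> t * (t - \<mu>)^2 + 2 * \<mu> * (normal_density \<mu> \<sigma> t * t) - \<mu>^2 * normal_density \<mu> \<sigma> t)"
    using assms by (intro Bochner_Integration.integrable_add Bochner_Integration.integrable_diff 
       integrable_mult_right integrable_normal_moment integrable_normal_moment_nz_1 integrable_normal_density) auto
  have "integrable lborel (\<lambda>t. normal_density \<mu> \<sigma> t * t^2)"
    by (rule Bochner_Integration.integrable_cong[THEN iffD1, OF refl _ 1]) (simp add: power2_eq_square algebra_simps)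
  then have "integrable (density lborel (\<lambda>t. ennreal (normal_density \<mu> \<sigma> t))) (\<lambda>t. t\<^sup>2)"
    by (subst integrable_density) auto
  then have "integrable (distr (state_law \<mu> \<sigma> :: (real^'n) measure) borel (\<lambda>x. x $ i)) (\<lambda>t. t\<^sup>2)"
    by (simp add: state_law_component[OF assms])
  then show ?thesis by (subst (asm) integrable_distr_eq) auto
qed

lemma kernel_measurable:
  assumes "public_signal M \<phi>"
  shows "(\<lambda>x. distr (\<phi> x) (borel \<Otimes>\<^sub>M M) (\<lambda>m. (x, m))) \<in> borel \<rightarrow>\<^sub>M prob_algebra (borel \<Otimes>\<^sub>M M)"
proof -
  have [measurable]: "\<phi> \<in> borel \<rightarrow>\<^sub>M prob_algebra M" using assms by (simp add: public_signal_def)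
  show ?thesis by (rule measurable_distr_prob_space2[where M=M]) auto
qed

lemma state_law_in: "\<sigma> > 0 \<Longrightarrow> state_law \<mu> \<sigma> \<in> space (prob_algebra borel)"
  by (simp add: space_prob_algebra prob_space_state_law)

lemma joint_law_facts:
  assumes "public_signal M \<phi>" "\<sigma> > 0"
  shows "prob_space (joint_law \<mu> \<sigma> M \<phi>)" "sets (joint_law \<mu> \<sigma> M \<phi>) = sets (borel \<Otimes>\<^sub>M M)"
    "space (joint_law \<mu> \<sigma> M \<phi>) = UNIV \<times> space M"
proof -
  show "prob_space (joint_law \<mu> \<sigma> M \<phi>)" 
    and *: "sets (joint_law \<mu> \<sigma> M \<phi>) = sets (borel \<Otimes>\<^sub>M M)"
    unfolding joint_law_def
    using prob_space_bind'[OF state_law_in kernel_measurable] sets_bind'[OF state_law_in kernel_measurable] assms by auto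
  show "space (joint_law \<mu> \<sigma> M \<phi>) = UNIV \<times> space M"
    using sets_eq_imp_space_eq[OF *] by (simp add: space_pair_measure)
qed

lemma nn_integral_joint_law_fst:
  assumes "public_signal M \<phi>" and "\<sigma> > 0"
    and [measurable]: "f \<in> borel_measurable borel"
  shows "(\<integral>\<^sup>+\<omega>. f (fst \<omega>) \<partial>joint_law \<mu> \<sigma> M \<phi>) = (\<integral>\<^sup>+x. f x \<partial>state_law \<mu> \<sigma>)"
proof -
  have [measurable]: "\<phi> \<in> borel \<rightarrow>\<^sub>M prob_algebra M" using assms by (simp add: public_signal_def)
  have "(\<integral>\<^sup>+\<omega>. f (fst \<omega>) \<partial>joint_law \<mu> \<sigma> M \<phi>) = 
    (\<integral>\<^sup>+x. \<integral>\<^sup>+\<omega>. f (fst \<omega>) \<partial>distr (\<phi> x) (borel \<Otimes>\<^sub>M M) (\<lambda>m. (x, m)) \<partial>state_law \<mu> \<sigma>)"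
    unfolding joint_law_def
    using measurable_prob_algebraD[OF kernel_measurable[OF assms(1)]]
    by (intro nn_integral_bind[where B="borel \<Otimes>\<^sub>M M"]) (auto cong: measurable_cong_sets)
  also have "\<dots> = (\<integral>\<^sup>+x. f x \<partial>state_law \<mu> \<sigma>)"
  proof (rule nn_integral_cong)
    fix x
    have x: "prob_space (\<phi> x)" "sets (\<phi> x) = sets M" 
      using measurable_space[of \<phi> borel "prob_algebra M" x] by (auto simp: space_prob_algebra)
    interpret prob_space "\<phi> x" by fact
    have "(\<lambda>m. (x, m)) \<in> \<phi> x \<rightarrow>\<^sub>M borel \<Otimes>\<^sub>M M"
      using x(2) by (simp cong: measurable_cong_sets)
    then show "(\<integral>\<^sup>+\<omega>. f (fst \<omega>) \<partial>distr (\<phi> x) (borel \<Otimes>\<^sub>M M) (\<lambda>m. (x, m))) = f x"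
      by (subst nn_integral_distr) (auto simp: emeasure_space_1)
  qed
  finally show ?thesis .
qed

lemma joint_law_integrable:
  assumes "public_signal M \<phi>" "\<sigma> > 0"
  shows "integrable (joint_law \<mu> \<sigma> M \<phi>) (\<lambda>\<omega>. (fst \<omega> $ i)\<^sup>2)"
    and "integrable (joint_law \<mu> \<sigma> M \<phi>) (\<lambda>\<omega>. fst \<omega> $ i)"
proof -
  interpret prob_space "joint_law \<mu> \<sigma> M \<phi>" using joint_law_facts assms by blast
  note [measurable_cong] = joint_law_facts(2)[OF assms, of \<mu>]
  have "(\<integral>\<^sup>+\<omega>. ennreal (norm ((fst \<omega> $ i)\<^sup>2)) \<partial>joint_law \<mu> \<sigma> M \<phi>) =
    (\<integral>\<^sup>+x. ennreal (norm ((x $ i)\<^sup>2)) \<partial>state_law \<mu> \<sigma>)"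
    by (rule nn_integral_joint_law_fst[OF assms]) simp
  also have "\<dots> < \<infinity>"
    using state_law_square_integrable[OF assms(2)] by (simp add: integrable_iff_bounded)
  finally show "integrable (joint_law \<mu> \<sigma> M \<phi>) (\<lambda>\<omega>. (fst \<omega> $ i)\<^sup>2)"
    by (intro integrableI_bounded) auto
  moreover have "(\<lambda>\<omega>. fst \<omega> $ i) \<in> borel_measurable (joint_law \<mu> \<sigma> M \<phi>)" by simp
  ultimately show "integrable (joint_law \<mu> \<sigma> M \<phi>) (\<lambda>\<omega>. fst \<omega> $ i)"
    by (rule square_integrable_imp_integrable[rotated])
qed

lemma snd_message_algebra [measurable]: "snd \<in> message_algebra M \<rightarrow>\<^sub>M M"
  unfolding message_algebra_def by (rule measurable_vimage_algebra1) auto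

lemma space_message_algebra: "space (message_algebra M) = UNIV \<times> space M"
  by (simp add: message_algebra_def)

lemma message_subalgebra:
  assumes "public_signal M \<phi>" "\<sigma> > 0"
  shows "sigma_finite_subalgebra (joint_law \<mu> \<sigma> M \<phi>) (message_algebra M)"
proof -
  interpret prob_space "joint_law \<mu> \<sigma> M \<phi>" using joint_law_facts assms by blast
  note [measurable_cong] = joint_law_facts(2)[OF assms, of \<mu>]
  have "snd \<in> joint_law \<mu> \<sigma> M \<phi> \<rightarrow>\<^sub>M M" by measurable
  then have "sets (message_algebra M) \<subseteq> sets (joint_law \<mu> \<sigma> M \<phi>)"
    unfolding message_algebra_def by (rule sets_image_in_sets[OF joint_law_facts(3)[OF assms]])
  then have "subalgebra (joint_law \<mu> \<sigma> M \<phi>) (message_algebra M)"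
    unfolding subalgebra_def by (simp add: space_message_algebra joint_law_facts(3)[OF assms])
  then have "finite_measure_subalgebra (joint_law \<mu> \<sigma> M \<phi>) (message_algebra M)"
    by (simp add: finite_measure_subalgebra_def finite_measure_subalgebra_axioms_def finite_measure_axioms)
  then show ?thesis by (rule finite_measure_subalgebra_is_sigma_finite)
qed

lemma message_factorization_nn:
  fixes g :: "'x \<times> 'm \<Rightarrow> ennreal"
  assumes "g \<in> borel_measurable (message_algebra M)"
  shows "\<exists>f \<in> borel_measurable M. \<forall>\<omega> \<in> UNIV \<times> space M. g \<omega> = f (snd \<omega>)"
  using assms
proof (induction rule: borel_measurable_induct)
  case (cong f g)
  then show ?case by (auto simp: space_message_algebra)
next
  case (set A)
  then obtain Y where Y: "Y \<in> sets M" "A = snd -` Y \<inter> (UNIV \<times> space M)"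
    unfolding message_algebra_def by (subst (asm) sets_vimage_algebra2) auto
  show ?case by (rule bexI[of _ "indicator Y"]) (use Y in \<open>auto split: split_indicator\<close>)
next
  case (mult u c)
  obtain f where [measurable]: "f \<in> borel_measurable M" 
    and f: "\<forall>\<omega> \<in> UNIV \<times> space M. u \<omega> = f (snd \<omega>)" using mult.IH by blast
  show ?case
  proof (rule bexI[of _ "\<lambda>m. c * f m"], rule ballI)
    fix \<omega> :: "'x \<times> 'm" assume "\<omega> \<in> UNIV \<times> space M"
    with f have "u \<omega> = f (snd \<omega>)" by blast
    then show "c * u \<omega> = c * f (snd \<omega>)" by simp
  qed measurable
next
  case (add u v)
  obtain f where [measurable]: "f \<in> borel_measurable M" 
    and f: "\<forall>\<omega> \<in> UNIV \<times> space M. u \<omega> = f (snd \<omega>)" using add.IH(1) by blast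
  obtain g where [measurable]: "g \<in> borel_measurable M" 
    and g: "\<forall>\<omega> \<in> UNIV \<times> space M. v \<omega> = g (snd \<omega>)" using add.IH(2) by blast
  show ?case
  proof (rule bexI[of _ "\<lambda>m. g m + f m"], rule ballI)
    fix \<omega> :: "'x \<times> 'm" assume "\<omega> \<in> UNIV \<times> space M"
    with f g have "u \<omega> = f (snd \<omega>)" "v \<omega> = g (snd \<omega>)" by blast+
    then show "v \<omega> + u \<omega> = g (snd \<omega>) + f (snd \<omega>)" by simp
  qed measurable
next
  case (seq U)
  have "\<forall>i. \<exists>f. f \<in> borel_measurable M \<and> (\<forall>\<omega> \<in> UNIV \<times> space M. U i \<omega> = f (snd \<omega>))"
    using seq.IH by blast
  then obtain f where f: "\<And>i. f i \<in> borel_measurable M"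
    "\<And>i. \<forall>\<omega> \<in> UNIV \<times> space M. U i \<omega> = f i (snd \<omega>)" 
    unfolding choice_iff by blast
  note [measurable] = f(1)
  show ?case
  proof (rule bexI[of _ "\<lambda>m. SUP i. f i m"], rule ballI)
    fix \<omega> :: "'x \<times> 'm" assume "\<omega> \<in> UNIV \<times> space M"
    then have "U i \<omega> = f i (snd \<omega>)" for i using f(2) by blast
    then show "(SUP i. U i) \<omega> = (SUP i. f i (snd \<omega>))" by (simp add: image_comp)
  qed measurable
qed

lemma message_factorization:
  fixes g :: "'x \<times> 'm \<Rightarrow> real"
  assumes [measurable]: "g \<in> borel_measurable (message_algebra M)"
  shows "\<exists>f \<in> borel_measurable M. \<forall>\<omega> \<in> UNIV \<times> space M. g \<omega> = f (snd \<omega>)"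
proof -
  obtain p q where [measurable]: "p \<in> borel_measurable M" "q \<in> borel_measurable M"
    and pq: "\<forall>\<omega> \<in> UNIV \<times> space M. ennreal (g \<omega>) = p (snd \<omega>)"
    "\<forall>\<omega> \<in> UNIV \<times> space M. ennreal (- g \<omega>) = q (snd \<omega>)"
    using message_factorization_nn[of "\<lambda>\<omega>. ennreal (g \<omega>)" M] message_factorization_nn[of "\<lambda>\<omega>. ennreal (- g \<omega>)" M]
    by auto
  have dec: "g \<omega> = enn2real (ennreal (g \<omega>)) - enn2real (ennreal (- g \<omega>))" for \<omega>
    by (cases "g \<omega> \<ge> 0") (auto simp: ennreal_neg)
  show ?thesis
  proof (intro bexI[of _ "\<lambda>m. enn2real (p m) - enn2real (q m)"] ballI)
    fix \<omega> :: "'x \<times> 'm" assume "\<omega> \<in> UNIV \<times> space M"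
    then show "g \<omega> = enn2real (p (snd \<omega>)) - enn2real (q (snd \<omega>))"
      using pq dec[of \<omega>] by metis
  qed measurable
qed

lemma (in sigma_finite_subalgebra) cond_exp_affine:
  fixes p r X Y :: "'a \<Rightarrow> real"
  assumes fin: "finite_measure M"
    and pF: "p \<in> borel_measurable F" and rF: "r \<in> borel_measurable F"
    and X: "integrable M X" and Y: "integrable M Y"
  shows "AE x in M. real_cond_exp M F (\<lambda>x. p x + r x * X x + Y x) x =
    p x + r x * real_cond_exp M F X x + real_cond_exp M F Y x"
proof -
  interpret finite_measure M by fact
  note [measurable] = pF rF measurable_from_subalg[OF subalg pF] measurable_from_subalg[OF subalg rF]
    borel_measurable_integrable[OF X] borel_measurable_integrable[OF Y]
  let ?u = "\<lambda>x. p x + r x * X x + Y x"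
  define h where "h k x = (if \<bar>p x\<bar> \<le> real k \<and> \<bar>r x\<bar> \<le> real k then 1 else 0 :: real)" for k x
  have hF [measurable]: "h k \<in> borel_measurable F" for k unfolding h_def by measurable
  note hM [measurable] = measurable_from_subalg[OF subalg hF]
  have "AE x in M. h k x = 1 \<longrightarrow> real_cond_exp M F ?u x =
    p x + r x * real_cond_exp M F X x + real_cond_exp M F Y x" for k
  proof -
    have i1: "integrable M (\<lambda>x. h k x * p x)"
      by (rule integrable_const_bound[where B="real k"]) (auto simp: h_def)
    have i2: "integrable M (\<lambda>x. (h k x * r x) * X x)"
    proof (rule Bochner_Integration.integrable_bound[where f="\<lambda>x. real k * X x"])
      show "AE x in M. norm (h k x * r x * X x) \<le> norm (real k * X x)"
        by (auto simp: h_def abs_mult intro!: mult_right_mono)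
    qed (use X in auto)
    have i3: "integrable M (\<lambda>x. h k x * Y x)"
      by (rule Bochner_Integration.integrable_bound[OF Y]) (auto simp: h_def)
    have i: "integrable M (\<lambda>x. h k x * p x + (h k x * r x) * X x)"
      using i1 i2 by auto
    have eq: "(\<lambda>x. h k x * ?u x) = (\<lambda>x. (h k x * p x + (h k x * r x) * X x) + h k x * Y x)"
      by (auto simp: algebra_simps)
    have "integrable M (\<lambda>x. h k x * ?u x)" unfolding eq using i i3 by auto
    then have "AE x in M. real_cond_exp M F (\<lambda>x. h k x * ?u x) x = h k x * real_cond_exp M F ?u x"
      by (intro real_cond_exp_mult) auto
    moreover have "AE x in M. real_cond_exp M F (\<lambda>x. h k x * p x + (h k x * r x) * X x + h k x * Y x) x
      = real_cond_exp M F (\<lambda>x. h k x * p x + (h k x * r x) * X x) x + real_cond_exp M F (\<lambda>x. h k x * Y x) x"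
      by (rule real_cond_exp_add[OF i i3])
    moreover have "AE x in M. real_cond_exp M F (\<lambda>x. h k x * p x + (h k x * r x) * X x) x
      = real_cond_exp M F (\<lambda>x. h k x * p x) x + real_cond_exp M F (\<lambda>x. (h k x * r x) * X x) x"
      by (rule real_cond_exp_add[OF i1 i2])
    moreover have "AE x in M. real_cond_exp M F (\<lambda>x. h k x * p x) x = h k x * p x"
      by (rule real_cond_exp_F_meas[OF i1]) measurable
    moreover have "AE x in M. real_cond_exp M F (\<lambda>x. (h k x * r x) * X x) x = (h k x * r x) * real_cond_exp M F X x"
      by (rule real_cond_exp_mult[OF _ _ i2]) measurable
    moreover have "AE x in M. real_cond_exp M F (\<lambda>x. h k x * Y x) x = h k x * real_cond_exp M F Y x"
      by (rule real_cond_exp_mult[OF _ _ i3]) measurable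
    ultimately show ?thesis unfolding eq[symmetric] by eventually_elim auto
  qed
  then have "AE x in M. \<forall>k. h k x = 1 \<longrightarrow> real_cond_exp M F ?u x =
    p x + r x * real_cond_exp M F X x + real_cond_exp M F Y x"
    by (subst AE_all_countable) blast
  then show ?thesis
  proof eventually_elim
    case (elim x)
    obtain k :: nat where "max \<bar>p x\<bar> \<bar>r x\<bar> \<le> real k" using real_arch_simple by blast
    then have "h k x = 1" by (simp add: h_def)
    then show ?case using elim by blast
  qed
qed


lemma cond_exp_message_borel [measurable]:
  "cond_exp_message \<mu> \<sigma> M \<phi> f \<in> borel_measurable (message_algebra M)"
  unfolding cond_exp_message_def by simp

definition response_objective :: "real \<Rightarrow> real^'n^'n \<Rightarrow> 'n \<Rightarrow> real \<Rightarrow> real^'n \<Rightarrow> real \<Rightarrow> real" where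
  "response_objective \<beta> G i xi a t =
     - t\<^sup>2 + 2 * t * xi - \<beta> * (\<Sum>j\<in>UNIV. G $ i $ j * (t - a $ j)\<^sup>2)"

lemma response_objective_eq:
  assumes "(1 + \<beta> * (\<Sum>j\<in>UNIV. G $ i $ j)) * s = xi + \<beta> * (\<Sum>j\<in>UNIV. G $ i $ j * a $ j)"
  shows "response_objective \<beta> G i xi a t =
    response_objective \<beta> G i xi a s - (1 + \<beta> * (\<Sum>j\<in>UNIV. G $ i $ j)) * (t - s)\<^sup>2"
proof -
  define D P Q where "D = (\<Sum>j\<in>UNIV. G $ i $ j)" and "P = (\<Sum>j\<in>UNIV. G $ i $ j * a $ j)"
    and "Q = (\<Sum>j\<in>UNIV. G $ i $ j * (a $ j)\<^sup>2)"
  have *: "(\<Sum>j\<in>UNIV. G $ i $ j * (t - a $ j)\<^sup>2) = D * t\<^sup>2 - 2 * t * P + Q" for t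
    unfolding D_def P_def Q_def
    by (simp add: power2_diff sum_distrib_left sum_distrib_right algebra_simps
        flip: sum.distrib sum_subtractf)
  have xi: "xi = (1 + \<beta> * D) * s - \<beta> * P" using assms unfolding D_def P_def by simp
  show ?thesis unfolding response_objective_def * D_def[symmetric] xi
    by (simp add: power2_eq_square algebra_simps)
qed

lemma cond_exp_agent_payoff:
  assumes "public_signal M \<phi>" "\<sigma> > 0" and G: "G $ i $ i = 0"
    and a: "a \<in> borel_measurable M" and d: "d \<in> borel_measurable M"
  shows "AE \<omega> in joint_law \<mu> \<sigma> M \<phi>.
     cond_exp_message \<mu> \<sigma> M \<phi>
       (\<lambda>(x, m). agent_payoff \<beta> G i (\<chi> j. if j = i then d m else a m $ j) x) \<omega> =
     response_objective \<beta> G i (posterior_mean \<mu> \<sigma> M \<phi> \<omega> $ i) (a (snd \<omega>)) (d (snd \<omega>))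
       + cond_exp_message \<mu> \<sigma> M \<phi> (\<lambda>(x, m). - (x $ i)\<^sup>2) \<omega>"
proof -
  interpret sigma_finite_subalgebra "joint_law \<mu> \<sigma> M \<phi>" "message_algebra M"
    by (rule message_subalgebra[OF assms(1,2)])
  interpret J: prob_space "joint_law \<mu> \<sigma> M \<phi>" using joint_law_facts assms by blast
  note [measurable] = a d
  have [measurable]: "(\<lambda>\<omega>. a (snd \<omega>) $ j) \<in> borel_measurable (message_algebra M)" for j
    by (rule measurable_compose[OF measurable_compose[OF snd_message_algebra a] vec_nth_borel])
  define p where "p \<omega> = - (d (snd \<omega>))\<^sup>2 - \<beta> * (\<Sum>j\<in>UNIV. G $ i $ j * (d (snd \<omega>) - a (snd \<omega>) $ j)\<^sup>2)" for \<omega> :: "(real^'b) \<times> 'a"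
  have eq: "(\<lambda>(x, m). agent_payoff \<beta> G i (\<chi> j. if j = i then d m else a m $ j) x) =
    (\<lambda>\<omega>. p \<omega> + 2 * d (snd \<omega>) * fst \<omega> $ i + - (fst \<omega> $ i)\<^sup>2)"
  proof (intro ext, clarify)
    fix x m
    have "(\<Sum>j\<in>UNIV. G $ i $ j * (d m - (if j = i then d m else a m $ j))\<^sup>2) =
       (\<Sum>j\<in>UNIV. G $ i $ j * (d m - a m $ j)\<^sup>2)"
      by (rule sum.cong) (auto simp: G)
    then show "agent_payoff \<beta> G i (\<chi> j. if j = i then d m else a m $ j) x =
       p (x, m) + 2 * d (snd (x, m)) * fst (x, m) $ i + - (fst (x, m) $ i)\<^sup>2"
      by (simp add: agent_payoff_def p_def power2_diff)
  qed
  have [measurable]: "p \<in> borel_measurable (message_algebra M)"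
    unfolding p_def by measurable
  have "AE \<omega> in joint_law \<mu> \<sigma> M \<phi>.
     cond_exp_message \<mu> \<sigma> M \<phi> (\<lambda>\<omega>. p \<omega> + 2 * d (snd \<omega>) * fst \<omega> $ i + - (fst \<omega> $ i)\<^sup>2) \<omega> =
     p \<omega> + 2 * d (snd \<omega>) * cond_exp_message \<mu> \<sigma> M \<phi> (\<lambda>\<omega>. fst \<omega> $ i) \<omega>
      + cond_exp_message \<mu> \<sigma> M \<phi> (\<lambda>\<omega>. - (fst \<omega> $ i)\<^sup>2) \<omega>"
    unfolding cond_exp_message_def
    by (rule cond_exp_affine)
       (auto simp: J.finite_measure_axioms intro!: joint_law_integrable assms)
  then show ?thesis
    unfolding eq posterior_mean_def
    by eventually_elim (simp add: response_objective_def p_def case_prod_unfold)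
qed

lemma equilibrium_matrix_component:
  "((mat 1 + \<beta> *\<^sub>R laplacian G) *v y) $ i =
    (1 + \<beta> * (\<Sum>j\<in>UNIV. G $ i $ j)) * y $ i - \<beta> * (\<Sum>j\<in>UNIV. G $ i $ j * y $ j)"
proof -
  have "(laplacian G *v y) $ i = (\<Sum>j\<in>UNIV. (if i = j then (\<Sum>k\<in>UNIV. G $ i $ k) * y $ j else 0) - G $ i $ j * y $ j)"
    by (auto simp: laplacian_def matrix_vector_mult_def algebra_simps intro!: sum.cong)
  also have "\<dots> = (\<Sum>k\<in>UNIV. G $ i $ k) * y $ i - (\<Sum>j\<in>UNIV. G $ i $ j * y $ j)"
    by (simp add: sum_subtractf)
  finally show ?thesis
    by (simp add: matrix_vector_mult_add_rdistrib scaleR_matrix_vector_assoc[symmetric]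
        distrib_right right_diff_distrib mult.assoc)
qed

lemma laplacian_quadratic_nonneg:
  assumes "graph_matrix G"
  shows "y \<bullet> (laplacian G *v y) \<ge> 0"
proof -
  have sym: "G $ i $ j = G $ j $ i" for i j
    using assms unfolding graph_matrix_def by (metis transpose_def vec_lambda_beta)
  have nn: "G $ i $ j \<ge> 0" for i j
    using assms unfolding graph_matrix_def by (metis insert_iff singletonD zero_le_one order_refl)
  define S where "S = (\<Sum>i\<in>UNIV. \<Sum>j\<in>UNIV. G $ i $ j * (y $ i)\<^sup>2)"
  have S2: "(\<Sum>i\<in>UNIV. \<Sum>j\<in>UNIV. G $ i $ j * (y $ j)\<^sup>2) = S"
    unfolding S_def by (subst sum.swap) (simp add: sym)
  define C where "C = (\<Sum>i\<in>UNIV. \<Sum>j\<in>UNIV. G $ i $ j * (y $ i * y $ j))"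
  have lap: "(laplacian G *v y) $ i = (\<Sum>k\<in>UNIV. G $ i $ k) * y $ i - (\<Sum>j\<in>UNIV. G $ i $ j * y $ j)" for i
    using equilibrium_matrix_component[of 1 G y i]
    by (simp add: matrix_vector_mult_add_rdistrib algebra_simps)
  have "y \<bullet> (laplacian G *v y) = S - C"
    unfolding inner_vec_def lap S_def C_def
    by (simp add: sum_distrib_left sum_distrib_right power2_eq_square algebra_simps
        flip: sum.distrib sum_subtractf)
  moreover have "(\<Sum>i\<in>UNIV. \<Sum>j\<in>UNIV. G $ i $ j * (y $ i - y $ j)\<^sup>2) = S + S - 2 * C"
    by (subst (2) S2[symmetric]) (simp add: S_def C_def power2_diff sum_distrib_left algebra_simps
        flip: sum.distrib sum_subtractf)
  moreover have "(\<Sum>i\<in>UNIV. \<Sum>j\<in>UNIV. G $ i $ j * (y $ i - y $ j)\<^sup>2) \<ge> 0"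
    by (intro sum_nonneg mult_nonneg_nonneg nn) auto
  ultimately show ?thesis by simp
qed

lemma equilibrium_matrix_invertible:
  assumes "graph_matrix G" "\<beta> \<ge> 0"
  shows "invertible (mat 1 + \<beta> *\<^sub>R laplacian G)"
proof -
  have "y = 0" if "(mat 1 + \<beta> *\<^sub>R laplacian G) *v y = 0" for y
  proof -
    have "0 = y \<bullet> ((mat 1 + \<beta> *\<^sub>R laplacian G) *v y)" using that by simp
    also have "\<dots> = y \<bullet> y + \<beta> * (y \<bullet> (laplacian G *v y))"
      by (simp add: matrix_vector_mult_add_rdistrib scaleR_matrix_vector_assoc[symmetric] inner_add_right)
    finally have "y \<bullet> y \<le> 0"
      using laplacian_quadratic_nonneg[OF assms(1), of y] assms(2)
      by (smt (verit) mult_nonneg_nonneg)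
    then show "y = 0" by (metis inner_ge_zero inner_eq_zero_iff order_antisym)
  qed
  then show ?thesis
    by (simp add: invertible_left_inverse matrix_left_invertible_ker)
qed

lemma equilibrium_matrix_inverse_iff:
  assumes "graph_matrix G" "\<beta> \<ge> 0"
  shows "y = matrix_inv (mat 1 + \<beta> *\<^sub>R laplacian G) *v z \<longleftrightarrow>
    (\<forall>i. (1 + \<beta> * (\<Sum>j\<in>UNIV. G $ i $ j)) * y $ i = z $ i + \<beta> * (\<Sum>j\<in>UNIV. G $ i $ j * y $ j))"
    (is "_ \<longleftrightarrow> ?R")
proof -
  let ?A = "mat 1 + \<beta> *\<^sub>R laplacian G"
  have "?R \<longleftrightarrow> ?A *v y = z"
    by (simp add: vec_eq_iff equilibrium_matrix_component) (auto simp: algebra_simps)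
  moreover have "y = matrix_inv ?A *v z \<longleftrightarrow> ?A *v y = z"
    using someI_ex[OF equilibrium_matrix_invertible[OF assms, unfolded invertible_def]]
    unfolding matrix_inv_def[symmetric]
    by (metis matrix_vector_mul_assoc matrix_vector_mul_lid)
  ultimately show ?thesis by simp
qed

theorem nash_equilibrium_iff:
  assumes sig: "public_signal M \<phi>" and \<sigma>: "\<sigma> > 0" and \<beta>: "\<beta> \<ge> 0" and G: "graph_matrix G"
  shows "nash_equilibrium \<mu> \<sigma> \<beta> G M \<phi> a \<longleftrightarrow>
    a \<in> borel_measurable M \<and>
    (AE \<omega> in joint_law \<mu> \<sigma> M \<phi>.
       a (snd \<omega>) = matrix_inv (mat 1 + \<beta> *\<^sub>R laplacian G) *v posterior_mean \<mu> \<sigma> M \<phi> \<omega>)"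
proof (cases "a \<in> borel_measurable M")
  case a: True
  let ?J = "joint_law \<mu> \<sigma> M \<phi>"
  define D where "D i = 1 + \<beta> * (\<Sum>j\<in>UNIV. G $ i $ j)" for i
  define x where "x \<omega> = posterior_mean \<mu> \<sigma> M \<phi> \<omega>" for \<omega>
  define R where "R i \<omega> \<longleftrightarrow> D i * a (snd \<omega>) $ i = x \<omega> $ i + \<beta> * (\<Sum>j\<in>UNIV. G $ i $ j * a (snd \<omega>) $ j)" for i \<omega>
  have Gii: "G $ i $ i = 0" for i using G by (simp add: graph_matrix_def)
  have D: "D i > 0" for i
  proof -
    have "G $ i $ j \<ge> 0" for j
      using G unfolding graph_matrix_def by (metis insert_iff singletonD zero_le_one order_refl)
    then show ?thesis unfolding D_def using \<beta>
      by (intro add_pos_nonneg mult_nonneg_nonneg sum_nonneg) auto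
  qed
  have self: "(\<chi> j. if j = i then a m $ i else a m $ j) = a m" for i m
    by (simp add: vec_eq_iff)
  have ai [measurable]: "(\<lambda>m. a m $ i) \<in> borel_measurable M" for i
    using a unfolding vec_borel_iff by blast
  define W where "W i \<omega> t = response_objective \<beta> G i (x \<omega> $ i) (a (snd \<omega>)) t" for i \<omega> t
  have iff: "(AE \<omega> in ?J.
      cond_exp_message \<mu> \<sigma> M \<phi>
          (\<lambda>(x, m). agent_payoff \<beta> G i (\<chi> j. if j = i then d m else a m $ j) x) \<omega>
        \<le> cond_exp_message \<mu> \<sigma> M \<phi> (\<lambda>(x, m). agent_payoff \<beta> G i (a m) x) \<omega>) \<longleftrightarrow>
      (AE \<omega> in ?J. W i \<omega> (d (snd \<omega>)) \<le> W i \<omega> (a (snd \<omega>) $ i))"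
    if "d \<in> borel_measurable M" for d i
  proof -
    have "AE \<omega> in ?J. (cond_exp_message \<mu> \<sigma> M \<phi>
          (\<lambda>(x, m). agent_payoff \<beta> G i (\<chi> j. if j = i then d m else a m $ j) x) \<omega>
        \<le> cond_exp_message \<mu> \<sigma> M \<phi> (\<lambda>(x, m). agent_payoff \<beta> G i (a m) x) \<omega>) \<longleftrightarrow>
      (W i \<omega> (d (snd \<omega>)) \<le> W i \<omega> (a (snd \<omega>) $ i))"
      using cond_exp_agent_payoff[OF sig \<sigma> Gii[of i] a that, of \<mu> \<beta>]
        cond_exp_agent_payoff[OF sig \<sigma> Gii[of i] a ai[of i], of \<mu> \<beta>]
      unfolding self W_def x_def by eventually_elim simp
    then show ?thesis by (rule eventually_subst)
  qed
  have "(\<forall>d\<in>borel_measurable M. AE \<omega> in ?J. W i \<omega> (d (snd \<omega>)) \<le> W i \<omega> (a (snd \<omega>) $ i)) \<longleftrightarrow>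
     (AE \<omega> in ?J. R i \<omega>)" for i
  proof
    assume R: "AE \<omega> in ?J. R i \<omega>"
    show "\<forall>d\<in>borel_measurable M. AE \<omega> in ?J. W i \<omega> (d (snd \<omega>)) \<le> W i \<omega> (a (snd \<omega>) $ i)"
    proof
      fix d
      show "AE \<omega> in ?J. W i \<omega> (d (snd \<omega>)) \<le> W i \<omega> (a (snd \<omega>) $ i)"
        using R
      proof eventually_elim
        case (elim \<omega>)
        have "D i * (d (snd \<omega>) - a (snd \<omega>) $ i)\<^sup>2 \<ge> 0" using D[of i] by simp
        with response_objective_eq[of \<beta> G i "a (snd \<omega>) $ i" "x \<omega> $ i" "a (snd \<omega>)" "d (snd \<omega>)"] elim
        show ?case unfolding W_def R_def D_def by simp
      qed
    qed
  next
    assume *: "\<forall>d\<in>borel_measurable M. AE \<omega> in ?J. W i \<omega> (d (snd \<omega>)) \<le> W i \<omega> (a (snd \<omega>) $ i)"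
    obtain f where f [measurable]: "f \<in> borel_measurable M"
      and fx: "\<forall>\<omega>\<in>UNIV \<times> space M. x \<omega> $ i = f (snd \<omega>)"
      using message_factorization[of "\<lambda>\<omega>. x \<omega> $ i" M] unfolding x_def posterior_mean_def by auto
    define d where "d m = (f m + \<beta> * (\<Sum>j\<in>UNIV. G $ i $ j * a m $ j)) / D i" for m
    have "d \<in> borel_measurable M" unfolding d_def by measurable
    with * have "AE \<omega> in ?J. W i \<omega> (d (snd \<omega>)) \<le> W i \<omega> (a (snd \<omega>) $ i)" by blast
    then show "AE \<omega> in ?J. R i \<omega>"
    proof (rule AE_mp, intro AE_I2 impI)
      fix \<omega> assume \<omega>: "\<omega> \<in> space ?J" and le: "W i \<omega> (d (snd \<omega>)) \<le> W i \<omega> (a (snd \<omega>) $ i)"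
      have "x \<omega> $ i = f (snd \<omega>)" using \<omega> fx joint_law_facts(3)[OF sig \<sigma>] by blast
      then have s: "D i * d (snd \<omega>) = x \<omega> $ i + \<beta> * (\<Sum>j\<in>UNIV. G $ i $ j * a (snd \<omega>) $ j)"
        using D[of i] by (simp add: d_def)
      have "D i * (a (snd \<omega>) $ i - d (snd \<omega>))\<^sup>2 \<le> 0"
        using response_objective_eq[OF s[unfolded D_def], of "a (snd \<omega>) $ i"] le
        unfolding W_def D_def by simp
      then have "a (snd \<omega>) $ i = d (snd \<omega>)"
        using D[of i] by (simp add: mult_le_0_iff)
      then show "R i \<omega>" using s by (simp add: R_def)
    qed
  qed
  then have "nash_equilibrium \<mu> \<sigma> \<beta> G M \<phi> a \<longleftrightarrow> (\<forall>i. AE \<omega> in ?J. R i \<omega>)"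
    unfolding nash_equilibrium_def using a iff by auto
  also have "\<dots> \<longleftrightarrow> (AE \<omega> in ?J. \<forall>i\<in>UNIV. R i \<omega>)"
    by (subst AE_finite_all) auto
  also have "\<dots> \<longleftrightarrow> (AE \<omega> in ?J. a (snd \<omega>) = matrix_inv (mat 1 + \<beta> *\<^sub>R laplacian G) *v x \<omega>)"
    unfolding equilibrium_matrix_inverse_iff[OF G \<beta>] R_def D_def by simp
  finally show ?thesis using a by (simp add: x_def)
qed (simp add: nash_equilibrium_def)

theorem nash_equilibrium_exists:
  assumes "public_signal M \<phi>" and "\<sigma> > 0" and "\<beta> \<ge> 0" and "graph_matrix G"
  shows "\<exists>a. nash_equilibrium \<mu> \<sigma> \<beta> G M \<phi> a"
proof -
  let ?B = "matrix_inv (mat 1 + \<beta> *\<^sub>R laplacian G)"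
  have "\<exists>f \<in> borel_measurable M. \<forall>\<omega>\<in>UNIV \<times> space M. posterior_mean \<mu> \<sigma> M \<phi> \<omega> $ i = f (snd \<omega>)" for i
    by (rule message_factorization) (simp add: posterior_mean_def)
  then obtain f where f: "\<And>i. f i \<in> borel_measurable M"
    "\<And>i. \<forall>\<omega>\<in>UNIV \<times> space M. posterior_mean \<mu> \<sigma> M \<phi> \<omega> $ i = f i (snd \<omega>)" by metis
  define g where "g m = (\<chi> i. f i m)" for m
  have [measurable]: "g \<in> borel_measurable M" unfolding vec_borel_iff g_def using f by simp
  have "posterior_mean \<mu> \<sigma> M \<phi> \<omega> = g (snd \<omega>)" if "\<omega> \<in> space (joint_law \<mu> \<sigma> M \<phi>)" for \<omega>
    using that f(2) joint_law_facts(3)[OF assms(1,2)] by (auto simp: vec_eq_iff g_def)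
  then have "nash_equilibrium \<mu> \<sigma> \<beta> G M \<phi> (\<lambda>m. ?B *v g m)"
    unfolding nash_equilibrium_iff[OF assms] by auto
  then show ?thesis by blast
qed

theorem principal_value_eq:
  assumes "public_signal M \<phi>" and "\<sigma> > 0" and "\<beta> \<ge> 0" and "graph_matrix G"
  shows "principal_value \<mu> \<sigma> \<beta> G Gt M \<phi> =
    (\<integral>\<omega>. principal_payoff \<beta> Gt
        (matrix_inv (mat 1 + \<beta> *\<^sub>R laplacian G) *v posterior_mean \<mu> \<sigma> M \<phi> \<omega>) (fst \<omega>)
      \<partial>joint_law \<mu> \<sigma> M \<phi>)"
proof -
  let ?B = "matrix_inv (mat 1 + \<beta> *\<^sub>R laplacian G)"
  let ?J = "joint_law \<mu> \<sigma> M \<phi>"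
  note [measurable_cong] = joint_law_facts(2)[OF assms(1,2), of \<mu>]
  have pp: "(\<lambda>\<omega>. principal_payoff \<beta> Gt (f \<omega>) (fst \<omega>)) \<in> borel_measurable ?J"
    if "f \<in> borel_measurable ?J" for f
  proof -
    have [measurable]: "(\<lambda>\<omega>. f \<omega> $ i) \<in> borel_measurable ?J" for i
      using that unfolding vec_borel_iff by blast
    show ?thesis unfolding principal_payoff_def by measurable
  qed
  have pm: "posterior_mean \<mu> \<sigma> M \<phi> \<in> borel_measurable ?J"
    unfolding vec_borel_iff posterior_mean_def cond_exp_message_def by simp
  have eq: "(\<integral>(x, m). principal_payoff \<beta> Gt (a m) x \<partial>?J) =
      (\<integral>\<omega>. principal_payoff \<beta> Gt (?B *v posterior_mean \<mu> \<sigma> M \<phi> \<omega>) (fst \<omega>) \<partial>?J)"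
    if "nash_equilibrium \<mu> \<sigma> \<beta> G M \<phi> a" for a
  proof -
    have [measurable]: "a \<in> borel_measurable M"
      and ae: "AE \<omega> in ?J. a (snd \<omega>) = ?B *v posterior_mean \<mu> \<sigma> M \<phi> \<omega>"
      using that nash_equilibrium_iff[OF assms] by auto
    show ?thesis unfolding case_prod_unfold
      by (rule integral_cong_AE) (use ae in \<open>auto intro!: pp mult_vec_borel pm\<close>)
  qed
  obtain a where "nash_equilibrium \<mu> \<sigma> \<beta> G M \<phi> a"
    using nash_equilibrium_exists[OF assms] by blast
  then show ?thesis unfolding principal_value_def
    by (intro the_equality) (use eq in auto)
qed

end

theory Submission
  imports Defs
begin

text \<open>
  Write \<open>A = I + \<beta> L\<close>, so that the equilibrium is \<open>a = A\<^sup>-\<^sup>1 E[x | m]\<close>, and put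
  \<open>b = A\<^sup>-\<^sup>1 x\<close>, the equilibrium under full revelation. With \<open>Lt\<close> the Laplacian of \<open>Gt\<close>, the
  payoff difference \<open>v(b, x) - v(a, x)\<close> is the quadratic form \<open>I + 2 \<beta> (L - Lt)\<close> at \<open>b - a\<close>
  plus a bilinear expression in \<open>x - E[x | m]\<close> and \<open>E[x | m]\<close>. The latter has expectation zero.
  If \<open>G\<close> contains \<open>Gt\<close>, then \<open>L - Lt\<close> is the Laplacian of the graph \<open>G - Gt\<close>, so the former is
  nonnegative.
\<close>

section \<open>Integrals of products and of matrix bilinear forms\<close>

lemma integrable_mult_of_square_integrable:
  fixes f g :: "'a \<Rightarrow> real"
  assumes [measurable]: "f \<in> borel_measurable M" "g \<in> borel_measurable M"
    and "integrable M (\<lambda>x. (f x)\<^sup>2)" "integrable M (\<lambda>x. (g x)\<^sup>2)"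
  shows "integrable M (\<lambda>x. f x * g x)"
proof (rule Bochner_Integration.integrable_bound)
  show "integrable M (\<lambda>x. (f x)\<^sup>2 + (g x)\<^sup>2)" using assms by simp
  have "\<bar>f x * g x\<bar> \<le> (f x)\<^sup>2 + (g x)\<^sup>2" for x
    using zero_le_power2[of "f x + g x"] zero_le_power2[of "f x - g x"]
      zero_le_power2[of "f x"] zero_le_power2[of "g x"]
    unfolding abs_le_iff power2_sum power2_diff by linarith
  then show "AE x in M. norm (f x * g x) \<le> norm ((f x)\<^sup>2 + (g x)\<^sup>2)" by simp
qed simp

text \<open>Expanding both matrix products turns the form into a finite linear combination of
  coordinate products, so only second moments of coordinates ever have to be studied.
  \<open>has_bochner_integral\<close> carries integrability and value together.\<close>

lemma has_bochner_integral_inner_matrix: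
  fixes f g :: "'a \<Rightarrow> real^'n"
  assumes "\<And>i j. has_bochner_integral M (\<lambda>x. f x $ i * g x $ j) (c i j)"
  shows "has_bochner_integral M (\<lambda>x. (A *v f x) \<bullet> (B *v g x))
    (\<Sum>k\<in>UNIV. \<Sum>i\<in>UNIV. \<Sum>j\<in>UNIV. (A $ k $ i * B $ k $ j) * c i j)"
proof -
  have "(\<lambda>x. (A *v f x) \<bullet> (B *v g x)) = 
    (\<lambda>x. \<Sum>k\<in>UNIV. \<Sum>i\<in>UNIV. \<Sum>j\<in>UNIV. (A $ k $ i * B $ k $ j) * (f x $ i * g x $ j))"
    by (simp add: inner_vec_def matrix_vector_mult_def sum_product ac_simps)
  then show ?thesis
    by (simp only:) (intro has_bochner_integral_sum has_bochner_integral_mult_right assms)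
qed

lemma integrable_inner_matrix:
  fixes f g :: "'a \<Rightarrow> real^'n"
  assumes "\<And>i j. integrable M (\<lambda>x. f x $ i * g x $ j)"
  shows "integrable M (\<lambda>x. (A *v f x) \<bullet> (B *v g x))"
  using has_bochner_integral_inner_matrix[OF has_bochner_integral_integrable, OF assms]
  by (rule integrable.intros)

section \<open>Linear algebra of graph Laplacians\<close>

lemma matrix_inv_equation:
  fixes A :: "real^'n^'n"
  assumes "invertible A"
  shows "A *v (matrix_inv A *v x) = x"
  using someI_ex[OF assms[unfolded invertible_def]]
  unfolding matrix_inv_def[symmetric] by (simp add: matrix_vector_mul_assoc)

lemma laplacian_diff: "laplacian (G - H) = laplacian G - laplacian H"
  by (simp add: laplacian_def vec_eq_iff sum_subtractf)

lemma graph_matrix_commute: "graph_matrix G \<Longrightarrow> G $ i $ j = G $ j $ i"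
  unfolding graph_matrix_def by (metis transpose_def vec_lambda_beta)

text \<open>Entrywise domination keeps the difference of two 0-1 entries in {0, 1}. So
  \<open>G - H\<close> is again a graph, and its Laplacian is positive semidefinite by
  \<open>laplacian_quadratic_nonneg\<close>.\<close>

lemma graph_matrix_diff:
  assumes "graph_matrix G" "graph_matrix H" "\<forall>i j. G $ i $ j \<ge> H $ i $ j"
  shows "graph_matrix (G - H)"
proof -
  have "(G - H) $ i $ j \<in> {0, 1}" for i j
  proof -
    have "G $ i $ j \<in> {0, 1}" "H $ i $ j \<in> {0, 1}" "G $ i $ j \<ge> H $ i $ j"
      using assms by (auto simp: graph_matrix_def)
    then show ?thesis by auto
  qed
  moreover have "transpose (G - H) = G - H"
    using graph_matrix_commute[OF assms(1)] graph_matrix_commute[OF assms(2)]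
    by (simp add: transpose_def vec_eq_iff)
  ultimately show ?thesis using assms by (simp add: graph_matrix_def)
qed

lemma laplacian_component:
  "(laplacian G *v y) $ i = (\<Sum>k\<in>UNIV. G $ i $ k) * y $ i - (\<Sum>j\<in>UNIV. G $ i $ j * y $ j)"
  using equilibrium_matrix_component[of 1 G y i]
  by (simp add: matrix_vector_mult_add_rdistrib algebra_simps)

lemma inner_laplacian:
  "x \<bullet> (laplacian G *v y) = (\<Sum>i\<in>UNIV. \<Sum>j\<in>UNIV. G $ i $ j * (x $ i * (y $ i - y $ j)))"
  by (simp add: inner_vec_def laplacian_component sum_distrib_left sum_distrib_right algebra_simps
      flip: sum_subtractf)

lemma inner_laplacian_commute:
  assumes "graph_matrix G"
  shows "x \<bullet> (laplacian G *v y) = y \<bullet> (laplacian G *v x)"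
proof -
  have "transpose (laplacian G) = laplacian G"
    using graph_matrix_commute[OF assms]
    by (auto simp: transpose_def vec_eq_iff laplacian_def)
  then show ?thesis
    by (metis dot_lmul_matrix inner_commute transpose_matrix_vector)
qed

text \<open>The double sum meets every edge in both orders, hence the factor 2. Each square splits
  as y_i (y_i - y_j) + y_j (y_j - y_i), and by symmetry of \<open>G\<close> exchanging the indices
  turns one half into the other.\<close>

lemma sum_edge_differences:
  assumes "graph_matrix G"
  shows "(\<Sum>i\<in>UNIV. \<Sum>j\<in>UNIV. G $ i $ j * (y $ i - y $ j)\<^sup>2) = 2 * (y \<bullet> (laplacian G *v y))"
proof -
  have "(\<Sum>i\<in>UNIV. \<Sum>j\<in>UNIV. G $ i $ j * (y $ i * (y $ i - y $ j))) =
    (\<Sum>i\<in>UNIV. \<Sum>j\<in>UNIV. G $ i $ j * (y $ j * (y $ j - y $ i)))"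
    by (subst sum.swap) (simp add: graph_matrix_commute[OF assms])
  moreover have "(\<Sum>i\<in>UNIV. \<Sum>j\<in>UNIV. G $ i $ j * (y $ i - y $ j)\<^sup>2) =
    (\<Sum>i\<in>UNIV. \<Sum>j\<in>UNIV. G $ i $ j * (y $ i * (y $ i - y $ j))) +
    (\<Sum>i\<in>UNIV. \<Sum>j\<in>UNIV. G $ i $ j * (y $ j * (y $ j - y $ i)))"
    by (simp add: power2_eq_square algebra_simps flip: sum.distrib)
  ultimately show ?thesis by (simp add: inner_laplacian)
qed

section \<open>The principal's payoff as a quadratic function\<close>

lemma principal_payoff_eq:
  assumes "graph_matrix Gt"
  shows "principal_payoff \<beta> Gt a x =
    - ((a - x) \<bullet> (a - x)) - 2 * \<beta> * (a \<bullet> (laplacian Gt *v a))"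
  unfolding principal_payoff_def sum_edge_differences[OF assms]
  by (simp add: inner_vec_def power2_eq_square)

text \<open>Writing the state as \<open>A *v b\<close> makes \<open>b\<close> the equilibrium under
  full revelation and keeps inverses out of the algebra. The correction is linear in
  \<open>b - a\<close>, so it averages to zero once \<open>a\<close> is the equilibrium for the
  posterior mean.\<close>

lemma principal_payoff_gap:
  fixes G Gt :: "real^'n^'n" and \<beta> :: real
  defines "A \<equiv> mat 1 + \<beta> *\<^sub>R laplacian G"
  assumes \<beta>: "\<beta> \<ge> 0" and G: "graph_matrix G" and Gt: "graph_matrix Gt"
    and le: "\<forall>i j. G $ i $ j \<ge> Gt $ i $ j"
  shows "principal_payoff \<beta> Gt a (A *v b)
      + 2 * \<beta> * ((b - a) \<bullet> ((laplacian G - 2 *\<^sub>R laplacian Gt) *v a))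
    \<le> principal_payoff \<beta> Gt b (A *v b)"
proof -
  let ?L = "laplacian G" and ?K = "laplacian Gt"
  define e where "e = b - a"
  have b: "b = a + e" by (simp add: e_def)
  \<comment> \<open>Expand around \<open>a\<close>: self-adjointness of both Laplacians merges the
    mixed terms into the linear correction, and the terms quadratic in \<open>e\<close>
    remain.\<close>
  have "principal_payoff \<beta> Gt b (A *v b) - principal_payoff \<beta> Gt a (A *v b)
      - 2 * \<beta> * (e \<bullet> ((?L - 2 *\<^sub>R ?K) *v a))
    = e \<bullet> e + 2 * \<beta> * (e \<bullet> (laplacian (G - Gt) *v e))"
    unfolding principal_payoff_eq[OF Gt] A_def b
    using inner_laplacian_commute[OF Gt, of a e] inner_laplacian_commute[OF G, of a e]
    by (simp add: laplacian_diff matrix_vector_mult_add_rdistrib matrix_vector_mult_diff_rdistrib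
        matrix_vector_right_distrib scaleR_matrix_vector_assoc[symmetric] inner_commute
        inner_add_left inner_add_right inner_diff_left inner_diff_right algebra_simps)
  moreover have "e \<bullet> (laplacian (G - Gt) *v e) \<ge> 0"
    by (rule laplacian_quadratic_nonneg[OF graph_matrix_diff[OF G Gt le]])
  ultimately show ?thesis
    using mult_nonneg_nonneg[OF \<beta>, of "e \<bullet> (laplacian (G - Gt) *v e)"] inner_ge_zero[of e]
    unfolding e_def by linarith
qed

lemma integrable_principal_payoff:
  fixes f g :: "'a \<Rightarrow> real^'n"
  assumes "graph_matrix Gt"
    and "\<And>i j. integrable M (\<lambda>x. f x $ i * f x $ j)"
    and "\<And>i j. integrable M (\<lambda>x. f x $ i * g x $ j)"
    and "\<And>i j. integrable M (\<lambda>x. g x $ i * g x $ j)"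
  shows "integrable M (\<lambda>x. principal_payoff \<beta> Gt (B *v f x) (g x))"
proof -
  \<comment> \<open>The factors \<open>mat 1\<close> bring all four terms into the shape required by
    \<open>integrable_inner_matrix\<close>.\<close>
  have "(\<lambda>x. principal_payoff \<beta> Gt (B *v f x) (g x)) = (\<lambda>x. 
      - ((B *v f x) \<bullet> (B *v f x)) + 2 * ((B *v f x) \<bullet> (mat 1 *v g x))
      - (mat 1 *v g x) \<bullet> (mat 1 *v g x)
      - 2 * \<beta> * ((B *v f x) \<bullet> ((laplacian Gt ** B) *v f x)))"
    by (simp add: principal_payoff_eq[OF assms(1)] matrix_vector_mul_assoc[symmetric]
        inner_diff_left inner_diff_right inner_commute fun_eq_iff)
  then show ?thesis
    by (simp only:) (intro Bochner_Integration.integrable_add Bochner_Integration.integrable_diff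
        Bochner_Integration.integrable_minus integrable_mult_right integrable_inner_matrix assms)
qed

section \<open>The state marginal and full revelation\<close>

lemma distr_joint_law_fst:
  fixes \<phi> :: "real^'n \<Rightarrow> 'm measure"
  assumes "public_signal M \<phi>" "\<sigma> > 0"
  shows "distr (joint_law \<mu> \<sigma> M \<phi>) borel fst = state_law \<mu> \<sigma>"
proof (rule measure_eqI)
  note [measurable_cong] = joint_law_facts(2)[OF assms, of \<mu>]
  fix S assume "S \<in> sets (distr (joint_law \<mu> \<sigma> M \<phi>) borel fst)"
  then have [measurable]: "S \<in> sets borel" by simp
  have "emeasure (distr (joint_law \<mu> \<sigma> M \<phi>) borel fst) S =
    (\<integral>\<^sup>+\<omega>. indicator S (fst \<omega>) \<partial>joint_law \<mu> \<sigma> M \<phi>)"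
    by (simp add: nn_integral_distr flip: nn_integral_indicator)
  also have "\<dots> = emeasure (state_law \<mu> \<sigma>) S"
    by (subst nn_integral_joint_law_fst[OF assms]) simp_all
  finally show "emeasure (distr (joint_law \<mu> \<sigma> M \<phi>) borel fst) S = emeasure (state_law \<mu> \<sigma>) S" .
qed simp

text \<open>Expectations of functions of the state do not depend on the signal. This lets two
  signals with different message spaces be compared under one joint law.\<close>

lemma integral_joint_law_fst:
  fixes f :: "real^'n \<Rightarrow> real"
  assumes "public_signal M \<phi>" "\<sigma> > 0" and [measurable]: "f \<in> borel_measurable borel"
  shows "(\<integral>\<omega>. f (fst \<omega>) \<partial>joint_law \<mu> \<sigma> M \<phi>) = (\<integral>x. f x \<partial>state_law \<mu> \<sigma>)"
proof -
  note [measurable_cong] = joint_law_facts(2)[OF assms(1,2), of \<mu>]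
  show ?thesis
    by (subst distr_joint_law_fst[OF assms(1,2), symmetric], subst integral_distr) simp_all
qed

lemma public_signal_full_revelation: "public_signal borel full_revelation"
  unfolding public_signal_def full_revelation_def
  by (rule measurable_prob_algebraI) (auto intro: prob_space_return)

text \<open>The joint law is the image of the state law under the diagonal map.\<close>

lemma AE_full_revelation:
  assumes "\<sigma> > 0"
  shows "AE \<omega> in joint_law \<mu> \<sigma> borel (full_revelation :: real^'n \<Rightarrow> _). snd \<omega> = fst \<omega>"
proof -
  have "distr (return borel x) (borel \<Otimes>\<^sub>M borel) (\<lambda>m. (x, m)) = return (borel \<Otimes>\<^sub>M borel) (x, x)"
    for x :: "real^'n"
    by (rule distr_return) auto
  then have "joint_law \<mu> \<sigma> borel (full_revelation :: real^'n \<Rightarrow> _) =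
      state_law \<mu> \<sigma> \<bind> (\<lambda>x. return (borel \<Otimes>\<^sub>M borel) (x, x))"
    by (simp add: joint_law_def full_revelation_def)
  also have "\<dots> = distr (state_law \<mu> \<sigma>) (borel \<Otimes>\<^sub>M borel) (\<lambda>x. (x, x))"
    by (rule bind_return_distr') auto
  finally show ?thesis
    by (simp only:) (subst AE_distr_iff; simp)
qed

text \<open>Almost surely the state coordinate equals the message coordinate. The latter is
  measurable for the message algebra, hence its own conditional expectation.\<close>

lemma posterior_mean_full_revelation:
  assumes "\<sigma> > 0"
  shows "AE \<omega> in joint_law \<mu> \<sigma> borel (full_revelation :: real^'n \<Rightarrow> _).
    posterior_mean \<mu> \<sigma> borel full_revelation \<omega> = fst \<omega>"
proof -
  let ?J = "joint_law \<mu> \<sigma> borel (full_revelation :: real^'n \<Rightarrow> _)"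
  note sig = public_signal_full_revelation
  note [measurable_cong] = joint_law_facts(2)[OF sig assms, of \<mu>]
  interpret sigma_finite_subalgebra ?J "message_algebra borel"
    by (rule message_subalgebra[OF sig assms])
  have "AE \<omega> in ?J. posterior_mean \<mu> \<sigma> borel full_revelation \<omega> $ i = fst \<omega> $ i" for i
  proof -
    have eq: "AE \<omega> in ?J. fst \<omega> $ i = snd \<omega> $ i"
      using AE_full_revelation[OF assms, of \<mu>] by eventually_elim simp
    have "integrable ?J (\<lambda>\<omega>. fst \<omega> $ i)" by (rule joint_law_integrable(2)[OF sig assms])
    then have "integrable ?J (\<lambda>\<omega>. snd \<omega> $ i)"
      by (subst (asm) integrable_cong_AE[OF _ _ eq]) auto
    then have "AE \<omega> in ?J. real_cond_exp ?J (message_algebra borel) (\<lambda>\<omega>. snd \<omega> $ i) \<omega> = snd \<omega> $ i"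
      by (rule real_cond_exp_F_meas) measurable
    moreover have "AE \<omega> in ?J. real_cond_exp ?J (message_algebra borel) (\<lambda>\<omega>. fst \<omega> $ i) \<omega> =
        real_cond_exp ?J (message_algebra borel) (\<lambda>\<omega>. snd \<omega> $ i) \<omega>"
      by (rule real_cond_exp_cong[OF eq]) auto
    ultimately show ?thesis using eq
      by eventually_elim (simp add: posterior_mean_def cond_exp_message_def case_prod_unfold)
  qed
  then have "AE \<omega> in ?J. \<forall>i\<in>UNIV. posterior_mean \<mu> \<sigma> borel full_revelation \<omega> $ i = fst \<omega> $ i"
    by (intro AE_finite_allI) auto
  then show ?thesis by eventually_elim (simp add: vec_eq_iff)
qed

section \<open>Second moments and orthogonality of the posterior error\<close>

lemma posterior_mean_moments:
  fixes \<phi> :: "real^'n \<Rightarrow> 'm measure" and \<mu> \<sigma> :: real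
  assumes "public_signal M \<phi>" "\<sigma> > 0"
  defines "J \<equiv> joint_law \<mu> \<sigma> M \<phi>" and "pm \<equiv> posterior_mean \<mu> \<sigma> M \<phi>"
  shows "integrable J (\<lambda>\<omega>. fst \<omega> $ i * fst \<omega> $ j)"
    and "integrable J (\<lambda>\<omega>. pm \<omega> $ i * fst \<omega> $ j)"
    and "integrable J (\<lambda>\<omega>. pm \<omega> $ i * pm \<omega> $ j)"
    and "(\<integral>\<omega>. pm \<omega> $ i * pm \<omega> $ j \<partial>J) = (\<integral>\<omega>. pm \<omega> $ i * fst \<omega> $ j \<partial>J)"
proof -
  note [measurable_cong] = joint_law_facts(2)[OF assms(1,2), of \<mu>, folded J_def]
  interpret prob_space J unfolding J_def by (rule joint_law_facts[OF assms(1,2)])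
  interpret sigma_finite_subalgebra J "message_algebra M"
    unfolding J_def by (rule message_subalgebra[OF assms(1,2)])
  have pm: "pm \<omega> $ k = real_cond_exp J (message_algebra M) (\<lambda>\<omega>. fst \<omega> $ k) \<omega>" for k \<omega>
    by (simp add: pm_def J_def posterior_mean_def cond_exp_message_def case_prod_unfold)
  have x2: "integrable J (\<lambda>\<omega>. (fst \<omega> $ i)\<^sup>2)" and x: "integrable J (\<lambda>\<omega>. fst \<omega> $ i)" for i
    unfolding J_def by (rule joint_law_integrable[OF assms(1,2)])+
  \<comment> \<open>Conditional Jensen inequality for the square.\<close>
  have p2: "integrable J (\<lambda>\<omega>. (pm \<omega> $ i)\<^sup>2)" for i
    unfolding pm by (rule integrable_convex_cond_exp[where I=UNIV, OF x])
      (auto intro: x2 convex_power2)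
  have [measurable]: "(\<lambda>\<omega>. fst \<omega> $ i) \<in> borel_measurable J"
    "(\<lambda>\<omega>. pm \<omega> $ i) \<in> borel_measurable J" for i
    unfolding pm by simp_all
  show "integrable J (\<lambda>\<omega>. fst \<omega> $ i * fst \<omega> $ j)"
    and *: "integrable J (\<lambda>\<omega>. pm \<omega> $ i * fst \<omega> $ j)"
    and "integrable J (\<lambda>\<omega>. pm \<omega> $ i * pm \<omega> $ j)"
    by (intro integrable_mult_of_square_integrable x2 p2; measurable)+
  show "(\<integral>\<omega>. pm \<omega> $ i * pm \<omega> $ j \<partial>J) = (\<integral>\<omega>. pm \<omega> $ i * fst \<omega> $ j \<partial>J)"
    unfolding pm[of _ j] by (rule real_cond_exp_intg(2)[OF *]) (simp_all add: pm)
qed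

text \<open>Each coordinate of the error is orthogonal in L2 to each coordinate of the posterior
  mean, and any bilinear form in the two inherits this.\<close>

lemma has_bochner_integral_posterior_error:
  fixes \<phi> :: "real^'n \<Rightarrow> 'm measure" and B C :: "real^'n^'n" and \<mu> \<sigma> :: real
  assumes "public_signal M \<phi>" "\<sigma> > 0"
  defines "J \<equiv> joint_law \<mu> \<sigma> M \<phi>" and "pm \<equiv> posterior_mean \<mu> \<sigma> M \<phi>"
  shows "has_bochner_integral J (\<lambda>\<omega>. (B *v (fst \<omega> - pm \<omega>)) \<bullet> (C *v pm \<omega>)) 0"
proof -
  note mom = posterior_mean_moments[OF assms(1,2), of \<mu>, folded J_def pm_def]
  have "has_bochner_integral J (\<lambda>\<omega>. (fst \<omega> - pm \<omega>) $ i * pm \<omega> $ j) 0" for i j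
  proof -
    have "has_bochner_integral J (\<lambda>\<omega>. pm \<omega> $ j * fst \<omega> $ i - pm \<omega> $ j * pm \<omega> $ i) 0"
      using has_bochner_integral_diff[OF has_bochner_integral_integrable[OF mom(2)[of j i]]
          has_bochner_integral_integrable[OF mom(3)[of j i]]]
      by (simp only: mom(4) diff_self)
    then show ?thesis by (simp add: algebra_simps)
  qed
  from has_bochner_integral_inner_matrix[OF this, of B C] show ?thesis by simp
qed

section \<open>Comparison of an arbitrary signal with full revelation\<close>

theorem proposition2:
  fixes G Gt :: "real^'n^'n" and \<mu> \<sigma> \<beta> :: real
  assumes "\<sigma> > 0" and "\<beta> \<ge> 0"
    and "graph_matrix G" and "graph_matrix Gt"
    and "\<forall>i j. G $ i $ j \<ge> Gt $ i $ j"
  shows "optimal_signal TYPE('m) \<mu> \<sigma> \<beta> G Gt borel full_revelation"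
  unfolding optimal_signal_def
proof (intro conjI allI impI public_signal_full_revelation)
  fix M :: "'m measure" and \<phi> :: "real^'n \<Rightarrow> 'm measure"
  assume sig: "public_signal M \<phi>"
  define A where "A = mat 1 + \<beta> *\<^sub>R laplacian G"
  define B where "B = matrix_inv A"
  define C where "C = laplacian G - 2 *\<^sub>R laplacian Gt"
  define J where "J = joint_law \<mu> \<sigma> M \<phi>"
  define F where "F = joint_law \<mu> \<sigma> borel (full_revelation :: real^'n \<Rightarrow> _)"
  define pm where "pm = posterior_mean \<mu> \<sigma> M \<phi>"
  define v where "v a x = principal_payoff \<beta> Gt a x" for a x
  note mom = posterior_mean_moments[OF sig assms(1), of \<mu>, folded J_def pm_def]
  have A: "A *v (B *v x) = x" for x
    unfolding A_def B_def
    by (rule matrix_inv_equation[OF equilibrium_matrix_invertible[OF assms(3,2)]])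
  have int: "integrable J (\<lambda>\<omega>. v (B *v pm \<omega>) (fst \<omega>))"
    "integrable J (\<lambda>\<omega>. v (B *v fst \<omega>) (fst \<omega>))"
    unfolding v_def by (intro integrable_principal_payoff assms mom)+
  have error: "has_bochner_integral J (\<lambda>\<omega>. (B *v (fst \<omega> - pm \<omega>)) \<bullet> ((C ** B) *v pm \<omega>)) 0"
    unfolding J_def pm_def by (rule has_bochner_integral_posterior_error[OF sig assms(1)])
  \<comment> \<open>The gap inequality with the equilibrium action as \<open>a\<close> and the
    full-revelation action as \<open>b\<close>; fact \<open>A\<close> identifies the state with
    \<open>A *v b\<close>.\<close>
  have gap: "v (B *v pm \<omega>) (fst \<omega>) + 2 * \<beta> * ((B *v (fst \<omega> - pm \<omega>)) \<bullet> ((C ** B) *v pm \<omega>))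
      \<le> v (B *v fst \<omega>) (fst \<omega>)" for \<omega>
    using principal_payoff_gap[OF assms(2-5), of "B *v pm \<omega>" "B *v fst \<omega>", folded A_def C_def]
    unfolding A by (simp add: v_def matrix_vector_mult_diff_distrib matrix_vector_mul_assoc)
  \<comment> \<open>Adding the term of zero mean makes the pointwise inequality \<open>gap\<close>
    applicable under the integral.\<close>
  have "(\<integral>\<omega>. v (B *v pm \<omega>) (fst \<omega>) \<partial>J) =
      (\<integral>\<omega>. v (B *v pm \<omega>) (fst \<omega>)
        + 2 * \<beta> * ((B *v (fst \<omega> - pm \<omega>)) \<bullet> ((C ** B) *v pm \<omega>)) \<partial>J)"
    using int(1) error by (simp add: has_bochner_integral_iff)
  also have "\<dots> \<le> (\<integral>\<omega>. v (B *v fst \<omega>) (fst \<omega>) \<partial>J)"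
    using int error gap by (intro integral_mono) (auto simp: has_bochner_integral_iff)
  finally have le: "(\<integral>\<omega>. v (B *v pm \<omega>) (fst \<omega>) \<partial>J) \<le> (\<integral>\<omega>. v (B *v fst \<omega>) (fst \<omega>) \<partial>J)" .
  have v_measurable: "(\<lambda>\<omega>. v (f \<omega>) (g \<omega>)) \<in> borel_measurable N"
    if [measurable]: "f \<in> borel_measurable N" "g \<in> borel_measurable N"
    for f g and N :: "'z measure"
    unfolding v_def principal_payoff_def by measurable
  \<comment> \<open>The bound involves the state alone, so it passes from \<open>J\<close> through
    the state law to \<open>F\<close>, where the state agrees almost surely with its posterior
    mean.\<close>
  have "(\<integral>\<omega>. v (B *v fst \<omega>) (fst \<omega>) \<partial>J) = (\<integral>x. v (B *v x) x \<partial>state_law \<mu> \<sigma>)"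
    unfolding J_def by (rule integral_joint_law_fst[OF sig assms(1)])
      (intro v_measurable mult_vec_borel; simp)
  also have "\<dots> = (\<integral>\<omega>. v (B *v fst \<omega>) (fst \<omega>) \<partial>F)"
    unfolding F_def
    by (rule integral_joint_law_fst[OF public_signal_full_revelation assms(1), symmetric])
      (intro v_measurable mult_vec_borel; simp)
  also have "\<dots> = (\<integral>\<omega>. v (B *v posterior_mean \<mu> \<sigma> borel full_revelation \<omega>) (fst \<omega>) \<partial>F)"
  proof (rule integral_cong_AE)
    have [measurable_cong]: "sets F = sets (borel \<Otimes>\<^sub>M borel)"
      unfolding F_def by (rule joint_law_facts(2)[OF public_signal_full_revelation assms(1)])
    have "posterior_mean \<mu> \<sigma> borel full_revelation \<in> borel_measurable F"
      unfolding vec_borel_iff posterior_mean_def cond_exp_message_def F_def by simp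
    then show "(\<lambda>\<omega>. v (B *v posterior_mean \<mu> \<sigma> borel full_revelation \<omega>) (fst \<omega>)) \<in> borel_measurable F"
      by (intro v_measurable mult_vec_borel) simp_all
    show "(\<lambda>\<omega>. v (B *v fst \<omega>) (fst \<omega>)) \<in> borel_measurable F"
      by (intro v_measurable mult_vec_borel) simp_all
    show "AE \<omega> in F. v (B *v fst \<omega>) (fst \<omega>) =
        v (B *v posterior_mean \<mu> \<sigma> borel full_revelation \<omega>) (fst \<omega>)"
      using posterior_mean_full_revelation[OF assms(1), of \<mu>] unfolding F_def
      by eventually_elim simp
  qed
  finally show "principal_value \<mu> \<sigma> \<beta> G Gt M \<phi> \<le> principal_value \<mu> \<sigma> \<beta> G Gt borel full_revelation"
    using le unfolding principal_value_eq[OF sig assms(1-3)]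
      principal_value_eq[OF public_signal_full_revelation assms(1-3)]
      v_def B_def A_def J_def F_def pm_def by simp
qed

end
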